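(* Let $\varphi:\mathbb{N}\to\mathbb{R}_+$ and let $\xi\ge 0$. If $\lim_{n\to\infty}\frac{\varphi(n)}n=\infty$, then $\dim E_\xi(\varphi)\le\frac12$.
   Context: For irrational $x\in[0,1)$ with partial quotients $a_1(x),a_2(x),\dots$ in its continued fraction expansion, $\gamma^\varphi(x)=\lim_{n\to\infty}\frac1{\varphi(n)}\sum_{j=1}^n\log a_j(x)$ when the limit exists, and $E_\xi(\varphi)=\{x\in[0,1):\gamma^\varphi(x)=\xi\}$. $\dim$ denotes Hausdorff dimension.
   Formalization: The formal theorem assumes ξ > 0 instead of ξ ≥ 0: for ξ = 0 the claim is false for every such φ, since E_0(φ) contains all irrationals in [0,1) with bounded partial quotients, a set of Hausdorff dimension 1. *)

theory Defs
  imports "HOL-Analysis.Analysis"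
begin

text \<open>Since \<open>0 powr 0 = 0\<close> in HOL, the exponent \<open>s = 0\<close> is treated separately, so that
  nonempty sets of diameter \<open>0\<close> count \<open>1\<close> for the zero-dimensional measure.\<close>

definition hausdorff_gauge :: "real \<Rightarrow> 'a::metric_space set \<Rightarrow> ennreal" where
  "hausdorff_gauge s U =
     (if U = {} then 0 else if s = 0 then 1 else ennreal (diameter U powr s))"

text \<open>Boundedness is required because \<open>diameter\<close> is meaningless on unbounded sets.
  Finite covers are included, by padding with empty sets.\<close>

definition hausdorff_premeasure :: "real \<Rightarrow> real \<Rightarrow> 'a::metric_space set \<Rightarrow> ennreal" where
  "hausdorff_premeasure s \<delta> A =
     (INF U \<in> {U :: nat \<Rightarrow> 'a set. A \<subseteq> (\<Union>i. U i) \<and> (\<forall>i. bounded (U i) \<and> diameter (U i) \<le> \<delta>)}.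
        (\<Sum>i. hausdorff_gauge s (U i)))"

definition hausdorff_measure :: "real \<Rightarrow> 'a::metric_space set \<Rightarrow> ennreal" where
  "hausdorff_measure s A = (SUP \<delta> \<in> {0<..}. hausdorff_premeasure s \<delta> A)"

definition hausdorff_dim :: "'a::metric_space set \<Rightarrow> ennreal" where
  "hausdorff_dim A = Inf {ennreal s | s. 0 \<le> s \<and> hausdorff_measure s A = 0}"

definition gauss_map :: "real \<Rightarrow> real" where
  "gauss_map x = (if x = 0 then 0 else frac (1 / x))"

text \<open>The \<open>n\<close>-th partial quotient of an irrational \<open>x \<in> [0,1)\<close>, indexed from \<open>n = 1\<close>.\<close>

definition partial_quotient :: "nat \<Rightarrow> real \<Rightarrow> int" where
  "partial_quotient n x = \<lfloor>1 / (gauss_map ^^ (n - 1)) x\<rfloor>"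

definition khinchin_average :: "(nat \<Rightarrow> real) \<Rightarrow> real \<Rightarrow> nat \<Rightarrow> real" where
  "khinchin_average \<phi> x n = (1 / \<phi> n) * (\<Sum>j=1..n. ln (real_of_int (partial_quotient j x)))"

definition khinchin_level_set :: "(nat \<Rightarrow> real) \<Rightarrow> real \<Rightarrow> real set" where
  "khinchin_level_set \<phi> \<xi> = {x \<in> {0..<1} - \<rat>. khinchin_average \<phi> x \<longlonglongrightarrow> \<xi>}"

end

theory Submission
  imports Defs "HOL-Real_Asymp.Real_Asymp"
begin

text \<open>If \<open>\<phi> n / n\<close> tends to infinity and \<open>\<xi> > 0\<close>, every \<open>x\<close> in the level set satisfies
  \<open>ln a\<^sub>1(x) + \<dots> + ln a\<^sub>n(x) \<ge> M n\<close> for all large \<open>n\<close>, whatever \<open>M\<close> is. A cylinder of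
  order \<open>n\<close> has diameter at most \<open>\<Prod> a\<^sub>j\<^sup>-\<^sup>2\<close>, so for \<open>s > 1/2\<close>, splitting \<open>2 s = p + c\<close> with
  \<open>p > 1\<close> and \<open>c > 0\<close>, the cylinders of order \<open>n\<close> on which the sum exceeds \<open>M n\<close> contribute at
  most \<open>(\<zeta>(p) e\<^bsup>-c M\<^esup>)\<^sup>n\<close> to the \<open>s\<close>-dimensional sum. For large \<open>M\<close> this is at most
  \<open>2\<^sup>-\<^sup>n\<close>, and covering by the cylinders of all orders \<open>n \<ge> N\<close> gives measure zero.\<close>

section \<open>Countable covers and sums over words\<close>

lemma hausdorff_gauge_empty [simp]: "hausdorff_gauge s {} = 0"
  by (simp add: hausdorff_gauge_def)

text \<open>Cylinders are indexed by words, \<open>hausdorff_premeasure\<close> by naturals: the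
  cover is transported along \<open>to_nat\<close>, and indices outside its range get
  \<open>{}\<close>, of gauge 0.\<close>

lemma hausdorff_premeasure_le_nn_integral:
  fixes U :: "'i::countable \<Rightarrow> 'a::metric_space set"
  assumes cover: "A \<subseteq> (\<Union>i. U i)" and "\<delta> \<ge> 0"
    and small: "\<And>i. bounded (U i)" "\<And>i. diameter (U i) \<le> \<delta>"
  shows "hausdorff_premeasure s \<delta> A \<le> (\<integral>\<^sup>+ i. hausdorff_gauge s (U i) \<partial>count_space UNIV)"
proof -
  define R where "R = range (to_nat :: 'i \<Rightarrow> nat)"
  define V where "V n = (if n \<in> R then U (from_nat n) else {})" for n
  have UV: "U i = V (to_nat i)" for i
    unfolding V_def R_def by (simp only: rangeI if_True from_nat_to_nat)
  have "A \<subseteq> (\<Union>n. V n)"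
    using cover by (rule order_trans) (auto simp only: UV)
  moreover have "bounded (V n) \<and> diameter (V n) \<le> \<delta>" for n
    using small \<open>\<delta> \<ge> 0\<close> by (simp add: V_def)
  ultimately have "hausdorff_premeasure s \<delta> A \<le> (\<Sum>n. hausdorff_gauge s (V n))"
    unfolding hausdorff_premeasure_def by (intro INF_lower) simp
  also have "\<dots> = (\<integral>\<^sup>+ n. hausdorff_gauge s (V n) \<partial>count_space UNIV)"
    by (simp add: nn_integral_count_space_nat)
  also have "\<dots> = (\<integral>\<^sup>+ n. hausdorff_gauge s (U (from_nat n)) * indicator R n \<partial>count_space UNIV)"
    by (intro nn_integral_cong) (simp add: V_def)
  also have "\<dots> = (\<integral>\<^sup>+ n. hausdorff_gauge s (U (from_nat n)) \<partial>count_space R)"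
    by (subst nn_integral_count_space_indicator) auto
  also have "\<dots> = (\<integral>\<^sup>+ i. hausdorff_gauge s (U (from_nat (to_nat (i :: 'i)))) \<partial>count_space UNIV)"
    by (intro nn_integral_bij_count_space[symmetric]) (simp add: R_def bij_betw_def)
  finally show ?thesis
    by simp
qed

text \<open>Nonempty words correspond to pairs of first letter and rest, so by Tonelli for counting
  measure the sum factorises, one factor per letter.\<close>

lemma nn_integral_prod_list_length:
  fixes g :: "'a \<Rightarrow> ennreal"
  shows "(\<integral>\<^sup>+ w. (if length w = n then prod_list (map g w) else 0) \<partial>count_space UNIV)
    = (\<integral>\<^sup>+ a. g a \<partial>count_space UNIV) ^ n"
proof (induction n)
  case 0
  have "(\<lambda>w. if length w = 0 then prod_list (map g w) else 0) = indicator {[]}"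
    by (auto simp: fun_eq_iff)
  then show ?case
    by simp
next
  case (Suc n)
  let ?F = "\<lambda>n w. if length w = n then prod_list (map g w) else 0"
  have bij: "bij_betw (\<lambda>(a, w). a # w) UNIV (- {[]} :: 'a list set)"
    by (auto simp: bij_betw_def inj_on_def image_def neq_Nil_conv)
  have "(\<integral>\<^sup>+ w. ?F (Suc n) w \<partial>count_space UNIV) 
      = (\<integral>\<^sup>+ w. ?F (Suc n) w * indicator (- {[]}) w \<partial>count_space UNIV)"
    by (intro nn_integral_cong) (auto simp: indicator_def)
  also have "\<dots> = (\<integral>\<^sup>+ w. ?F (Suc n) w \<partial>count_space (- {[]}))"
    by (subst nn_integral_count_space_indicator) auto
  also have "\<dots> = (\<integral>\<^sup>+ z. ?F (Suc n) (case z of (a, w) \<Rightarrow> a # w) \<partial>count_space UNIV)"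
    by (intro nn_integral_bij_count_space[symmetric] bij)
  also have "\<dots> = (\<integral>\<^sup>+ z. g (fst z) * ?F n (snd z) \<partial>count_space UNIV)"
    by (intro nn_integral_cong) auto
  also have "\<dots> = (\<integral>\<^sup>+ a. \<integral>\<^sup>+ w. g a * ?F n w \<partial>count_space UNIV \<partial>count_space UNIV)"
    by (subst nn_integral_fst_count_space[symmetric]) (simp only: fst_conv snd_conv)
  also have "\<dots> = (\<integral>\<^sup>+ a. g a \<partial>count_space UNIV) ^ Suc n"
    by (simp add: nn_integral_cmult nn_integral_multc Suc.IH)
  finally show ?case .
qed

text \<open>A word of length at least \<open>N\<close> contributes for exactly one \<open>n\<close>,
  namely \<open>length w - N\<close>, so sum and integral can be exchanged.\<close>

lemma nn_integral_prod_list_length_ge: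
  fixes g :: "'a \<Rightarrow> ennreal"
  shows "(\<integral>\<^sup>+ w. (if length w \<ge> N then prod_list (map g w) else 0) \<partial>count_space UNIV)
    = (\<Sum>n. (\<integral>\<^sup>+ a. g a \<partial>count_space UNIV) ^ (n + N))"
proof -
  have "(if length w \<ge> N then prod_list (map g w) else 0)
     = (\<Sum>n. if length w = n + N then prod_list (map g w) else 0)" for w
    by (subst suminf_finite[of "{length w - N}"]) auto
  then show ?thesis
    by (simp add: nn_integral_suminf nn_integral_prod_list_length)
qed

section \<open>Continued fraction words and cylinders\<close>

lemma gauss_map_irrational:
  assumes "x \<in> {0<..<1} - \<rat>"
  shows "gauss_map x \<in> {0<..<1} - \<rat>"
proof -
  have "frac (1 / x) \<notin> \<rat>"
  proof
    assume "frac (1 / x) \<in> \<rat>"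
    then have "1 / x \<in> \<rat>"
      by (metis Rats_add Rats_of_int diff_add_cancel frac_def)
    from Rats_inverse[OF this] show False
      using assms by simp
  qed
  moreover from this have "frac (1 / x) \<noteq> 0"
    by (metis Rats_0)
  ultimately show ?thesis
    using assms frac_ge_0[of "1 / x"] frac_lt_1[of "1 / x"] by (auto simp: gauss_map_def less_le)
qed

text \<open>Recursion on the first quotient matches induction on words; \<open>nat\<close> loses
  nothing, as the quotients of irrationals in (0,1) are at least 1.\<close>

primrec cf_word :: "nat \<Rightarrow> real \<Rightarrow> nat list" where
  "cf_word 0 x = []"
| "cf_word (Suc n) x = nat \<lfloor>1 / x\<rfloor> # cf_word n (gauss_map x)"

definition log_sum :: "nat list \<Rightarrow> real" where
  "log_sum w = (\<Sum>a\<leftarrow>w. ln (real a))"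

lemma log_sum_simps [simp]:
  "log_sum [] = 0" "log_sum (a # w) = ln (real a) + log_sum w"
  by (simp_all add: log_sum_def)

definition cylinder :: "nat list \<Rightarrow> real set" where
  "cylinder w = {x \<in> {0<..<1} - \<rat>. cf_word (length w) x = w}"

lemma length_cf_word [simp]: "length (cf_word n x) = n"
  by (induction n arbitrary: x) auto

lemma floor_inverse_ge_1:
  assumes "x \<in> {0<..<1::real}"
  shows "\<lfloor>1 / x\<rfloor> \<ge> 1"
  using assms by (simp add: le_floor_iff)

lemma log_sum_cf_word:
  assumes "x \<in> {0<..<1} - \<rat>"
  shows "log_sum (cf_word n x) = (\<Sum>j=1..n. ln (real_of_int (partial_quotient j x)))"
  using assms
proof (induction n arbitrary: x)
  case (Suc n)
  have "(\<Sum>j=1..n. ln (real_of_int (partial_quotient j (gauss_map x))))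
     = (\<Sum>j=1..n. ln (real_of_int (partial_quotient (Suc j) x)))"
  proof (intro sum.cong refl)
    fix j assume "j \<in> {1..n}"
    \<comment> \<open>The shift needs \<open>j\<close> positive: at \<open>j = 0\<close> the
      truncated \<open>j - 1\<close> in \<open>partial_quotient\<close> is no predecessor.\<close>
    then obtain i where "j = Suc i"
      by (cases j) auto
    then show "ln (real_of_int (partial_quotient j (gauss_map x)))
        = ln (real_of_int (partial_quotient (Suc j) x))"
      by (simp add: partial_quotient_def funpow_swap1)
  qed
  moreover have "(\<Sum>j=1..Suc n. ln (real_of_int (partial_quotient j x)))
     = ln (real_of_int (partial_quotient 1 x))
      + (\<Sum>j=1..n. ln (real_of_int (partial_quotient (Suc j) x)))"
    using sum.atLeast_Suc_atMost[of 1 "Suc n" "\<lambda>j. ln (real_of_int (partial_quotient j x))"]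
      sum.shift_bounds_cl_Suc_ivl[of "\<lambda>j. ln (real_of_int (partial_quotient j x))" 1 n]
    by simp
  ultimately show ?case
    using Suc floor_inverse_ge_1[of x] gauss_map_irrational[of x]
    by (simp add: partial_quotient_def)
qed simp

lemma cylinder_Cons_iff:
  "x \<in> cylinder (a # w) \<longleftrightarrow>
    x \<in> {0<..<1} - \<rat> \<and> nat \<lfloor>1 / x\<rfloor> = a \<and> gauss_map x \<in> cylinder w"
  using gauss_map_irrational[of x] by (auto simp: cylinder_def)

text \<open>Words containing 0 have empty cylinders. This rules out the letter 0, where
  \<open>ln\<close> and \<open>powr\<close> only take default values.\<close>

lemma cylinder_positive:
  assumes "x \<in> cylinder w"
  shows "\<forall>a\<in>set w. a \<ge> 1"
  using assms
proof (induction w arbitrary: x)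
  case (Cons a w)
  then have "\<lfloor>1 / x\<rfloor> \<ge> 1" "nat \<lfloor>1 / x\<rfloor> = a" "\<forall>b\<in>set w. b \<ge> 1"
    using floor_inverse_ge_1[of x] unfolding cylinder_Cons_iff by blast+
  moreover from this(1,2) have "a \<ge> 1"
    by linarith
  ultimately show ?case
    by simp
qed simp

text \<open>\<open>x = 1 / (a + T x)\<close> with \<open>a\<close> the first partial quotient and \<open>T\<close> the Gauss map, so each
  common partial quotient contracts the distance by \<open>1 / a\<^sup>2\<close>.\<close>

lemma cylinder_dist_le:
  assumes "x \<in> cylinder w" "y \<in> cylinder w"
  shows "dist x y \<le> exp (- 2 * log_sum w)"
  using assms
proof (induction w arbitrary: x y)
  case Nil
  then show ?case
    by (auto simp: cylinder_def dist_real_def)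
next
  case (Cons a w)
  have x: "x \<in> {0<..<1}" "nat \<lfloor>1 / x\<rfloor> = a" "gauss_map x \<in> cylinder w"
    and y: "y \<in> {0<..<1}" "nat \<lfloor>1 / y\<rfloor> = a" "gauss_map y \<in> cylinder w"
    using Cons.prems by (simp_all add: cylinder_Cons_iff)
  have a: "a \<ge> 1" "real_of_int \<lfloor>1 / x\<rfloor> = real a" "real_of_int \<lfloor>1 / y\<rfloor> = real a"
    using floor_inverse_ge_1[OF x(1)] floor_inverse_ge_1[OF y(1)] x(2) y(2) by linarith+
  have eq: "1 / x = real a + gauss_map x" "1 / y = real a + gauss_map y"
    using x y a by (auto simp: gauss_map_def frac_def)
  have ge: "real a \<le> 1 / x" "real a \<le> 1 / y"
    using a of_int_floor_le[of "1 / x"] of_int_floor_le[of "1 / y"] by simp_all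
  have xa: "x \<le> 1 / real a" and ya: "y \<le> 1 / real a"
    using ge x y a by (simp_all add: field_simps)
  \<comment> \<open>The common quotient \<open>a\<close> cancels in \<open>1 / y - 1 / x\<close>,
    which leaves the Gauss images and the contracting factor \<open>x * y\<close>.\<close>
  have "x - y = x * y * (1 / y - 1 / x)"
    using x y by (simp add: field_simps)
  also have "\<dots> = x * y * (gauss_map y - gauss_map x)"
    using eq by simp
  finally have "dist x y = x * y * dist (gauss_map x) (gauss_map y)"
    using x y by (simp add: dist_real_def abs_mult abs_minus_commute)
  also have "\<dots> \<le> (1 / real a) * (1 / real a) * exp (- 2 * log_sum w)"
    using xa ya x y Cons.IH[OF x(3) y(3)] by (intro mult_mono) auto
  also have "\<dots> = exp (- 2 * log_sum (a # w))"
    using a by (simp add: exp_diff exp_add exp_minus exp_double field_simps power2_eq_square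
        distrib_left)
  finally show ?case .
qed

lemma diameter_cylinder_le: "diameter (cylinder w) \<le> exp (- 2 * log_sum w)"
  by (intro diameter_le) (use cylinder_dist_le[of _ w] in \<open>auto simp: dist_real_def\<close>)

lemma bounded_cylinder: "bounded (cylinder w)"
  by (rule bounded_subset[of "{0<..<1}"]) (auto simp: cylinder_def)

section \<open>Gauge estimates and measure zero\<close>

text \<open>In the exponent \<open>2 * s\<close>, the share \<open>c\<close> of
  \<open>log_sum w\<close> is traded for \<open>M\<close> per letter and the share \<open>p\<close>
  is kept. The bound becomes multiplicative in the letters, hence summable over words.\<close>

lemma hausdorff_gauge_cylinder_le:
  assumes "s > 0" "2 * s = p + c" "c \<ge> 0" "log_sum w \<ge> M * real (length w)"
  shows "hausdorff_gauge s (cylinder w)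
    \<le> prod_list (map (\<lambda>a. ennreal (exp (- c * M) * real a powr - p)) w)"
proof (cases "cylinder w = {}")
  case False
  then have pos: "\<forall>a\<in>set w. a \<ge> 1"
    using cylinder_positive by blast
  have "prod_list (map (\<lambda>a. ennreal (exp (- c * M) * real a powr - p)) w)
      = ennreal (exp (- c * M * real (length w)) * exp (- p * log_sum w))"
    using pos
  proof (induction w)
    case (Cons a w)
    have "ennreal (exp (- c * M) * real a powr - p)
        * ennreal (exp (- c * M * real (length w)) * exp (- p * log_sum w))
       = ennreal ((exp (- c * M) * real a powr - p)
        * (exp (- c * M * real (length w)) * exp (- p * log_sum w)))"
      by (simp add: ennreal_mult)
    also have "(exp (- c * M) * real a powr - p)
        * (exp (- c * M * real (length w)) * exp (- p * log_sum w))
        = exp (- c * M * real (length (a # w))) * exp (- p * log_sum (a # w))"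
      using Cons.prems by (simp add: powr_def flip: exp_add) (simp add: algebra_simps)
    finally show ?case
      using Cons by simp
  qed simp
  moreover have "diameter (cylinder w) powr s
      \<le> exp (- c * M * real (length w)) * exp (- p * log_sum w)"
  proof -
    have "diameter (cylinder w) powr s \<le> exp (- 2 * log_sum w) powr s"
      using assms by (intro powr_mono2 diameter_cylinder_le diameter_ge_0 bounded_cylinder) auto
    also have "\<dots> = exp (- (2 * s) * log_sum w)"
      by (simp add: powr_def)
    also have "\<dots> = exp (- c * log_sum w) * exp (- p * log_sum w)"
      unfolding assms(2) by (simp add: algebra_simps flip: exp_add)
    also have "\<dots> \<le> exp (- c * M * real (length w)) * exp (- p * log_sum w)"
      using mult_left_mono[OF assms(4,3)] by (simp add: mult.assoc)
    finally show ?thesis .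
  qed
  ultimately show ?thesis
    using False assms by (simp add: hausdorff_gauge_def ennreal_leI)
qed simp

lemma ennreal_suminf_half_powers: "(\<Sum>n. ennreal (1 / 2) ^ (n + N)) = ennreal (2 * (1 / 2) ^ N)"
proof -
  have "(\<lambda>n. (1 / 2 :: real) ^ n * (1 / 2) ^ N) sums (2 * (1 / 2) ^ N)"
    by (intro sums_mult2) (use geometric_sums[of "1 / 2 :: real"] in simp)
  then have "(\<lambda>n. (1 / 2 :: real) ^ (n + N)) sums (2 * (1 / 2) ^ N)"
    by (simp add: power_add)
  then show ?thesis
    by (subst ennreal_power) (auto intro!: suminf_ennreal_eq)
qed

text \<open>Borel-Cantelli argument: for every \<open>N\<close> the selected cylinders of order at
  least \<open>N\<close> cover the set, with total gauge at most a geometric tail.\<close>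

lemma hausdorff_measure_log_sum_frequently_ge:
  fixes s p c M :: real
  assumes "s > 0" "2 * s = p + c" "c \<ge> 0" "M > 0"
    and half: "(\<integral>\<^sup>+ a. ennreal (exp (- c * M) * real a powr - p) \<partial>count_space UNIV) \<le> ennreal (1 / 2)"
  shows "hausdorff_measure s
    {x \<in> {0<..<1} - \<rat>. \<exists>\<^sub>F n in sequentially. log_sum (cf_word n x) \<ge> M * real n} = 0"
    (is "hausdorff_measure s ?A = 0")
proof -
  have "hausdorff_premeasure s \<delta> ?A = 0" if "\<delta> > 0" for \<delta>
  proof -
    \<comment> \<open>A selected word of length at least \<open>N\<close> has \<open>log_sum\<close>
      at least \<open>M * N\<close>, so \<open>exp (- 2 * M * N)\<close> bounds the diameters and is
      below \<delta> for large \<open>N\<close>.\<close>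
    have "((\<lambda>n. exp (- 2 * M * real n)) \<longlongrightarrow> 0) sequentially"
      using \<open>M > 0\<close> by real_asymp
    then have ev: "\<forall>\<^sub>F n in sequentially. exp (- 2 * M * real n) < \<delta>"
      using \<open>\<delta> > 0\<close> by (rule order_tendstoD)
    have "hausdorff_premeasure s \<delta> ?A \<le> ennreal (2 * (1 / 2) ^ N)"
      if N: "exp (- 2 * M * real N) < \<delta>" for N
    proof -
      \<comment> \<open>Rejected words get the empty set, so the cover is indexed by the countable
        type of all words.\<close>
      define U where "U w = (if length w \<ge> N \<and> log_sum w \<ge> M * real (length w)
          then cylinder w else {})" for w
      have "?A \<subseteq> (\<Union>w. U w)"
      proof
        fix x assume x: "x \<in> ?A"
        then obtain n where "n \<ge> N" "log_sum (cf_word n x) \<ge> M * real n"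
          by (auto simp: frequently_sequentially)
        then have "x \<in> U (cf_word n x)"
          using x by (simp add: U_def cylinder_def)
        then show "x \<in> (\<Union>w. U w)"
          by blast
      qed
      moreover have "bounded (U w)" for w
        by (simp add: U_def bounded_cylinder)
      moreover have "diameter (U w) \<le> \<delta>" for w
      proof (cases "length w \<ge> N \<and> log_sum w \<ge> M * real (length w)")
        case True
        then have "M * real N \<le> M * real (length w)"
          using \<open>M > 0\<close> by simp
        then have "M * real N \<le> log_sum w"
          using True by linarith
        then have "exp (- 2 * log_sum w) \<le> exp (- 2 * M * real N)"
          by simp
        then have "diameter (cylinder w) \<le> \<delta>"
          using N diameter_cylinder_le[of w] by linarith
        then show ?thesis
          using True by (simp add: U_def)
      qed (use \<open>\<delta> > 0\<close> in \<open>auto simp: U_def\<close>)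
      ultimately have "hausdorff_premeasure s \<delta> ?A
          \<le> (\<integral>\<^sup>+ w. hausdorff_gauge s (U w) \<partial>count_space UNIV)"
        using \<open>\<delta> > 0\<close> by (intro hausdorff_premeasure_le_nn_integral) auto
      also have "\<dots> \<le> (\<integral>\<^sup>+ w. (if length w \<ge> N then
          prod_list (map (\<lambda>a. ennreal (exp (- c * M) * real a powr - p)) w) else 0) \<partial>count_space UNIV)"
      proof (intro nn_integral_mono)
        fix w
        show "hausdorff_gauge s (U w) \<le> (if length w \<ge> N then
            prod_list (map (\<lambda>a. ennreal (exp (- c * M) * real a powr - p)) w) else 0)"
          using hausdorff_gauge_cylinder_le[OF assms(1-3), of M w]
          by (simp add: U_def)
      qed
      also have "\<dots> \<le> (\<Sum>n. ennreal (1 / 2) ^ (n + N))"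
        unfolding nn_integral_prod_list_length_ge
        by (intro suminf_le power_mono half) auto
      finally show ?thesis
        by (simp only: ennreal_suminf_half_powers)
    qed
    \<comment> \<open>The premeasure does not depend on \<open>N\<close>, so letting
      \<open>N\<close> grow forces it to be 0.\<close>
    then have "\<forall>\<^sub>F N in sequentially. hausdorff_premeasure s \<delta> ?A \<le> ennreal (2 * (1 / 2) ^ N)"
      using ev by (auto elim: eventually_mono)
    moreover have "(\<lambda>N. ennreal (2 * (1 / 2) ^ N)) \<longlonglongrightarrow> ennreal 0"
      by (intro tendsto_ennrealI) real_asymp
    ultimately have "hausdorff_premeasure s \<delta> ?A \<le> ennreal 0"
      by (intro tendsto_lowerbound) auto
    then show ?thesis
      by simp
  qed
  then show ?thesis
    by (simp add: hausdorff_measure_def)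
qed

text \<open>The series over \<open>a\<close> converges because \<open>p > 1\<close>; the factor
  \<open>exp (- c * M)\<close> is common to all \<open>a\<close> and small for large
  \<open>M\<close>.\<close>

lemma exists_contracting_weight:
  fixes p c :: real
  assumes "p > 1" "c > 0"
  obtains M where "M > 0"
    "(\<integral>\<^sup>+ a. ennreal (exp (- c * M) * real a powr - p) \<partial>count_space UNIV) \<le> ennreal (1 / 2)"
proof -
  \<comment> \<open>Since \<open>0 powr - p\<close> is 0, the index 0 adds nothing and
    \<open>Z\<close> is the zeta value at \<open>p\<close>.\<close>
  define Z where "Z = (\<Sum>a. real a powr - p)"
  have sm: "summable (\<lambda>a. real a powr - p)"
    using assms by (simp add: summable_real_powr_iff)
  have "((\<lambda>M. exp (- c * M) * Z) \<longlongrightarrow> 0) at_top"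
    using assms by real_asymp
  then have "\<forall>\<^sub>F M in at_top. exp (- c * M) * Z < 1 / 2"
    by (rule order_tendstoD) simp
  then have "\<forall>\<^sub>F M in at_top. exp (- c * M) * Z < 1 / 2 \<and> M > 0"
    using eventually_gt_at_top by (rule eventually_conj)
  then obtain M where M: "exp (- c * M) * Z < 1 / 2" "M > 0"
    by (auto dest: eventually_happens)
  have "(\<integral>\<^sup>+ a. ennreal (exp (- c * M) * real a powr - p) \<partial>count_space UNIV)
      = ennreal (exp (- c * M) * Z)"
    unfolding nn_integral_count_space_nat Z_def
    by (intro suminf_ennreal_eq sums_mult summable_sums sm) simp
  then show thesis
    using M by (intro that[of M]) (simp_all only: ennreal_leI less_imp_le)
qed

section \<open>Level sets and the dimension bound\<close>

lemma hausdorff_measure_mono: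
  assumes "A \<subseteq> B"
  shows "hausdorff_measure s A \<le> hausdorff_measure s B"
  unfolding hausdorff_measure_def hausdorff_premeasure_def
  using assms by (intro SUP_mono' INF_superset_mono) auto

text \<open>Eventually the average exceeds \<open>\<xi> / 2\<close>, a positive number, and
  \<open>\<phi> n / n\<close> is at least \<open>2 * M / \<xi>\<close>; these two bounds multiply to
  \<open>M\<close>.\<close>

lemma khinchin_level_set_log_sum_ge:
  assumes "\<And>n. n \<ge> 1 \<Longrightarrow> \<phi> n > 0" "\<xi> > 0"
    and "filterlim (\<lambda>n. \<phi> n / real n) at_top sequentially"
    and x: "x \<in> khinchin_level_set \<phi> \<xi>" and "M > 0"
  shows "x \<in> {0<..<1} - \<rat>" "\<forall>\<^sub>F n in sequentially. log_sum (cf_word n x) \<ge> M * real n"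
proof -
  have "x \<noteq> 0"
    using x by (auto simp: khinchin_level_set_def)
  then show irr: "x \<in> {0<..<1} - \<rat>"
    using x by (auto simp: khinchin_level_set_def)
  have "khinchin_average \<phi> x \<longlonglongrightarrow> \<xi>"
    using x by (simp add: khinchin_level_set_def)
  then have "\<forall>\<^sub>F n in sequentially. khinchin_average \<phi> x n > \<xi> / 2"
    using \<open>\<xi> > 0\<close> by (intro order_tendstoD) auto
  moreover have "\<forall>\<^sub>F n in sequentially. \<phi> n / real n \<ge> 2 * M / \<xi>"
    using assms(3) by (simp add: filterlim_at_top)
  ultimately show "\<forall>\<^sub>F n in sequentially. log_sum (cf_word n x) \<ge> M * real n"
    \<comment> \<open>\<open>n \<ge> 1\<close> gives \<open>\<phi> n > 0\<close> and allows clearing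
      the denominator \<open>real n\<close>.\<close>
    using eventually_ge_at_top[of 1]
  proof eventually_elim
    case (elim n)
    have "M * real n \<le> \<xi> / 2 * \<phi> n"
      using elim \<open>\<xi> > 0\<close> by (simp add: field_simps)
    also have "\<dots> \<le> khinchin_average \<phi> x n * \<phi> n"
      using elim assms(1)[of n] by (intro mult_right_mono) auto
    also have "\<dots> = log_sum (cf_word n x)"
      using elim assms(1)[of n] by (simp add: khinchin_average_def log_sum_cf_word[OF irr])
    finally show ?case .
  qed
qed

theorem lemma3p3:
  fixes \<phi> :: "nat \<Rightarrow> real" and \<xi> :: real
  assumes "\<And>n. n \<ge> 1 \<Longrightarrow> \<phi> n > 0"
    and "\<xi> > 0"
    and "filterlim (\<lambda>n. \<phi> n / real n) at_top sequentially"
  shows "hausdorff_dim (khinchin_level_set \<phi> \<xi>) \<le> 1 / 2"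
proof -
  have dim_le: "hausdorff_dim (khinchin_level_set \<phi> \<xi>) \<le> ennreal s" if "s > 1 / 2" for s
  proof -
    \<comment> \<open>Both \<open>p > 1\<close> and \<open>c > 0\<close> amount to
      \<open>s > 1 / 2\<close>, which is where the critical exponent comes from.\<close>
    define p c where "p = s + 1 / 2" and "c = s - 1 / 2"
    have pc: "p > 1" "c > 0" "2 * s = p + c"
      using that by (simp_all add: p_def c_def)
    obtain M where M: "M > 0"
      "(\<integral>\<^sup>+ a. ennreal (exp (- c * M) * real a powr - p) \<partial>count_space UNIV) \<le> ennreal (1 / 2)"
      using exists_contracting_weight[OF pc(1,2)] .
    \<comment> \<open>The lower bound holds for all large \<open>n\<close>, in particular for
      infinitely many.\<close>
    have "khinchin_level_set \<phi> \<xi>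
        \<subseteq> {x \<in> {0<..<1} - \<rat>. \<exists>\<^sub>F n in sequentially. log_sum (cf_word n x) \<ge> M * real n}"
      using khinchin_level_set_log_sum_ge[OF assms _ M(1)]
      by (blast intro: eventually_frequently[OF sequentially_bot])
    then have "hausdorff_measure s (khinchin_level_set \<phi> \<xi>) \<le> 0"
      using hausdorff_measure_mono hausdorff_measure_log_sum_frequently_ge[OF _ pc(3) _ M] that pc
      by (metis (no_types, lifting) less_eq_real_def less_trans zero_less_divide_1_iff zero_less_numeral)
    then show ?thesis
      using that unfolding hausdorff_dim_def by (intro Inf_lower) auto
  qed
  \<comment> \<open>\<open>dim_le\<close> needs \<open>s\<close> strictly above 1/2, so the endpoint
    is reached through \<open>s = 1 / 2 + e\<close> with arbitrary \<open>e > 0\<close>.\<close>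
  have "hausdorff_dim (khinchin_level_set \<phi> \<xi>) \<le> ennreal (1 / 2)"
  proof (rule ennreal_le_epsilon)
    fix e :: real assume "e > 0"
    then show "hausdorff_dim (khinchin_level_set \<phi> \<xi>) \<le> ennreal (1 / 2) + ennreal e"
      using dim_le[of "1 / 2 + e"] by (subst ennreal_plus[symmetric]) simp_all
  qed
  also have "ennreal (1 / 2) = 1 / 2"
    by (simp add: divide_ennreal_def)
  finally show ?thesis .
qed

end
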